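(* For every integer $k\ge 2$ there exists a word $\gamma_k$ such that, for all $n\ge k$, $\gamma_k$ is a primitive generator of $\alpha^{(k)}_n$.
   Context: For $k\ge 2$, let $\sigma\colon\{1,\dots,k\}^*\to\{1,\dots,k\}^*$ be the monoid endomorphism with $\sigma(i)=1\cdot(i+1)$ (the two-letter word consisting of the letter $1$ followed by the letter $i+1$) for $i<k$, and $\sigma(k)=1$. Define $\alpha^{(k)}_1=1$ and $\alpha^{(k)}_{n+1}=\sigma(\alpha^{(k)}_n)$ for $n\ge 1$. For integers $i,k$, $[i,k]=\{j\in\mathbb{Z}: i\le j\le k\}$. For a word $u=a_1\cdots a_n$ and $f\colon[1,m]\to[1,n]$, $u^f=a_{f(1)}\cdots a_{f(m)}$. A walk is a surjection $f\colon[1,m]\to[1,n]$ with $|f(i+1)-f(i)|\le1$ for $1\le i<m$. A word $u$ generates $w$ if $w=u^f$ for some walk $f$; $u$ is primitive if it is not generated by any strictly shorter word; a primitive generator of $w$ is a primitive word that generates $w$. *)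

theory Defs
  imports Main
begin

text \<open>
  Words are lists. Positions in words, and hence the domains and ranges of walks, are numbered
  from 1 as in the mathematics, whereas list indexing starts at 0; this accounts for the shift
  in \<^term>\<open>u ! (f i - 1)\<close> below.
\<close>

definition reindex :: "'a list \<Rightarrow> nat \<Rightarrow> (nat \<Rightarrow> nat) \<Rightarrow> 'a list" where
  "reindex u m f = map (\<lambda>i. u ! (f i - 1)) [1..<Suc m]"

text \<open>Only the values of \<open>f\<close> on \<open>{1..m}\<close> matter.\<close>

definition walk :: "nat \<Rightarrow> nat \<Rightarrow> (nat \<Rightarrow> nat) \<Rightarrow> bool" where
  "walk m n f \<longleftrightarrow>
     f ` {1..m} = {1..n} \<and>
     (\<forall>i. 1 \<le> i \<and> i < m \<longrightarrow> \<bar>int (f (i + 1)) - int (f i)\<bar> \<le> 1)"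

definition generates :: "'a list \<Rightarrow> 'a list \<Rightarrow> bool" where
  "generates u w \<longleftrightarrow> (\<exists>m f. walk m (length u) f \<and> w = reindex u m f)"

definition primitive :: "'a list \<Rightarrow> bool" where
  "primitive u \<longleftrightarrow> \<not> (\<exists>v. length v < length u \<and> generates v u)"

definition primitive_generator :: "'a list \<Rightarrow> 'a list \<Rightarrow> bool" where
  "primitive_generator u w \<longleftrightarrow> primitive u \<and> generates u w"

text \<open>
  The alphabet \<open>{1..k}\<close> is represented inside \<^typ>\<open>nat\<close>; the values of \<open>\<sigma>\<close> on letters outside
  \<open>{1..k}\<close> are irrelevant, as such letters never occur in the words \<open>\<alpha>\<close>.
\<close>

definition sigma_letter :: "nat \<Rightarrow> nat \<Rightarrow> nat list" where
  "sigma_letter k i = (if i < k then [1, i + 1] else [1])"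

definition sigma :: "nat \<Rightarrow> nat list \<Rightarrow> nat list" where
  "sigma k w = concat (map (sigma_letter k) w)"

text \<open>The sequence is indexed from 1; the value at 0 is a dummy.\<close>

fun alpha :: "nat \<Rightarrow> nat \<Rightarrow> nat list" where
  "alpha k 0 = []"
| "alpha k (Suc 0) = [1]"
| "alpha k (Suc (Suc n)) = sigma k (alpha k (Suc n))"

end

theory Submission
  imports Defs
begin

text \<open>
  Take \<open>\<gamma>\<^sub>2 = 12\<close>, and let \<open>\<gamma>\<close> at \<open>k + 1\<close> arise from \<open>\<gamma>\<close> at \<open>k\<close> by incrementing all letters and
  inserting a \<open>1\<close> between any two neighbours. Given a step-bounded path on \<open>\<gamma>\<close> at \<open>k\<close>, any word
  obtained from the word read along it by incrementing letters and inserting at least one \<open>1\<close>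
  between neighbours can be read along \<open>\<gamma>\<close> at \<open>k + 1\<close>: where the path stays put, step to an
  adjacent \<open>1\<close> and back. If \<open>k < K\<close>, deleting the letters above \<open>k + 1\<close> from \<open>\<sigma>\<^sub>K(w)\<close> gives such a
  word, obtained from \<open>w\<close> with the letters above \<open>k\<close> deleted. Hence \<open>\<sigma>\<^sub>K\<close> iterated \<open>k - 2\<close> times
  on any word can be read on \<open>\<gamma>\<close> at \<open>k\<close>, once the letters above \<open>k\<close> are deleted.

  For primitivity, halving maps a path \<open>f\<close> that generates \<open>\<gamma>\<close> at \<open>k + 1\<close> to one that generates
  \<open>\<gamma>\<close> at \<open>k\<close>; inductively, the end points of \<open>f\<close> are as far apart as possible.
\<close>

text \<open>The word \<open>\<gamma>\<^sub>k\<close> consists of the letters \<open>gamma_letter (k - 2) x\<close> for \<open>x = 0, \<dots>, 2\<^bsup>k-2\<^esup>\<close>.\<close>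

fun gamma_letter :: "nat \<Rightarrow> nat \<Rightarrow> nat" where
  "gamma_letter 0 x = Suc x"
| "gamma_letter (Suc j) x = (if even x then Suc (gamma_letter j (x div 2)) else 1)"

definition gamma :: "nat \<Rightarrow> nat list" where
  "gamma j = map (gamma_letter j) [0..<Suc (2 ^ j)]"

lemma length_gamma [simp]: "length (gamma j) = Suc (2 ^ j)"
  by (simp add: gamma_def)

lemma gamma_nth: "x \<le> 2 ^ j \<Longrightarrow> gamma j ! x = gamma_letter j x"
  unfolding gamma_def by (subst nth_map) (auto simp del: upt_Suc)

lemma gamma_letter_pos: "gamma_letter j x \<ge> 1"
  by (cases j) auto

lemma gamma_letter_eq_top: "x \<le> 2 ^ j \<Longrightarrow> gamma_letter j x = j + 2 \<Longrightarrow> x = 2 ^ j"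
proof (induction j arbitrary: x)
  case (Suc j)
  then have "even x" "gamma_letter j (x div 2) = j + 2"
    by (auto split: if_splits)
  with Suc.IH[of "x div 2"] Suc.prems(1) show ?case
    by (auto elim!: evenE)
qed simp

lemma gamma_letter_eq_bottom: "gamma_letter j x = j + 1 \<Longrightarrow> x = 0"
proof (induction j arbitrary: x)
  case (Suc j)
  then have "even x" "gamma_letter j (x div 2) = j + 1"
    by (auto split: if_splits)
  with Suc.IH[of "x div 2"] show ?case
    by (auto elim!: evenE)
qed simp


section \<open>Primitivity\<close>

text \<open>The second assumption says that the letter depends only on the position visited. Values
  are integers because the halved path \<open>h\<close> in the induction starts at 0 and may go
  either way.\<close>

lemma gamma_letter_path_ends:
  fixes f :: "nat \<Rightarrow> int"
  assumes "\<And>i. i < 2 ^ j \<Longrightarrow> \<bar>f (Suc i) - f i\<bar> \<le> 1"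
    and "\<And>i i'. i \<le> 2 ^ j \<Longrightarrow> i' \<le> 2 ^ j \<Longrightarrow> f i = f i' \<Longrightarrow> gamma_letter j i = gamma_letter j i'"
  shows "\<bar>f (2 ^ j) - f 0\<bar> = 2 ^ j"
  using assms
proof (induction j arbitrary: f)
  case 0
  from "0.prems"(2)[of 0 1] have "f 0 \<noteq> f 1" by auto
  with "0.prems"(1)[of 0] show ?case by simp
next
  case (Suc j)
  \<comment> \<open>Of two neighbouring letters exactly one is an inserted \<open>1\<close>; the
    other is at least 2, so the path cannot stay put.\<close>
  have odd_step: "\<bar>f (Suc i) - f i\<bar> = 1" if "i < 2 ^ Suc j" for i
  proof -
    have "gamma_letter (Suc j) i \<noteq> gamma_letter (Suc j) (Suc i)"
      using gamma_letter_pos[of j "i div 2"] gamma_letter_pos[of j "Suc i div 2"] by auto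
    with Suc.prems(2)[of i "Suc i"] that have "f i \<noteq> f (Suc i)"
      by auto
    with Suc.prems(1)[OF that] show ?thesis by linarith
  qed
  have double_step: "f (2 * Suc i) - f (2 * i) \<in> {-2, 0, 2}" if "i < 2 ^ j" for i
    using odd_step[of "2 * i"] odd_step[of "Suc (2 * i)"] that by auto
  have even_diff: "even (f (2 * i) - f 0)" if "i \<le> 2 ^ j" for i
    using that
  proof (induction i)
    case (Suc i)
    from double_step[of i] Suc.prems
    have "even (f (2 * Suc i) - f (2 * i))" by fastforce
    moreover have "even (f (2 * i) - f 0)" using Suc by simp
    ultimately have "even ((f (2 * Suc i) - f (2 * i)) + (f (2 * i) - f 0))"
      by (rule dvd_add)
    then show ?case by simp
  qed simp
  \<comment> \<open>Even indices carry the incremented letters of level \<open>j\<close>, so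
    \<open>h\<close> inherits both assumptions.\<close>
  define h where "h i = (f (2 * i) - f 0) div 2" for i
  have h: "f (2 * i) = f 0 + 2 * h i" if "i \<le> 2 ^ j" for i
    using even_diff[OF that] by (simp add: h_def)
  have "\<bar>h (2 ^ j) - h 0\<bar> = 2 ^ j"
  proof (rule Suc.IH)
    fix i :: nat assume i: "i < 2 ^ j"
    show "\<bar>h (Suc i) - h i\<bar> \<le> 1"
      using double_step[OF i] h[of i] h[of "Suc i"] i by auto
  next
    fix i i' :: nat assume i: "i \<le> 2 ^ j" "i' \<le> 2 ^ j" "h i = h i'"
    then have "f (2 * i) = f (2 * i')" using h by simp
    with Suc.prems(2)[of "2 * i" "2 * i'"] i show "gamma_letter j i = gamma_letter j i'"
      by simp
  qed
  with h[of "2 ^ j"] h[of 0] show ?case by simp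
qed

lemma primitive_gamma: "primitive (gamma j)"
  unfolding primitive_def
proof
  assume "\<exists>v. length v < length (gamma j) \<and> generates v (gamma j)"
  then obtain v m f where v: "length v < length (gamma j)" and f: "walk m (length v) f"
    and eq: "gamma j = reindex v m f"
    unfolding generates_def by blast
  have "length (gamma j) = m" unfolding eq by (simp add: reindex_def)
  then have m: "m = Suc (2 ^ j)" by simp
  have letter: "gamma_letter j i = v ! (f (Suc i) - 1)" if "i \<le> 2 ^ j" for i
  proof -
    have "gamma_letter j i = reindex v m f ! i"
      using gamma_nth[OF that] eq by simp
    also have "\<dots> = v ! (f (Suc i) - 1)"
      unfolding reindex_def using that by (subst nth_map) (auto simp: m simp del: upt_Suc)
    finally show ?thesis .
  qed
  \<comment> \<open>A distance of \<open>2 ^ j\<close> needs \<open>2 ^ j + 1\<close> positions,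
    more than \<open>v\<close> has.\<close>
  have "\<bar>int (f (Suc (2 ^ j))) - int (f (Suc 0))\<bar> = 2 ^ j"
  proof (rule gamma_letter_path_ends[where f = "\<lambda>i. int (f (Suc i))"])
    fix i :: nat assume "i < 2 ^ j"
    then have "1 \<le> Suc i \<and> Suc i < m" by (simp add: m)
    with f have "\<bar>int (f (Suc i + 1)) - int (f (Suc i))\<bar> \<le> 1"
      unfolding walk_def by blast
    then show "\<bar>int (f (Suc (Suc i))) - int (f (Suc i))\<bar> \<le> 1" by simp
  qed (simp add: letter)
  moreover have "f (Suc (2 ^ j)) \<in> {1..length v}" "f (Suc 0) \<in> {1..length v}"
    using f m unfolding walk_def by auto
  moreover have "int (length v) \<le> 2 ^ j"
  proof -
    from v have "length v \<le> 2 ^ j" by simp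
    then have "int (length v) \<le> int (2 ^ j)" by (rule of_nat_mono)
    then show ?thesis by simp
  qed
  ultimately show False unfolding atLeastAtMost_iff by linarith
qed


section \<open>Reading words along paths\<close>

definition adjacent :: "nat \<Rightarrow> nat \<Rightarrow> bool" where
  "adjacent x y \<longleftrightarrow> x \<le> Suc y \<and> y \<le> Suc x"

text \<open>Surjectivity is left out so that arbitrary words can be treated;
  \<open>generates_gamma\<close> recovers it. Positions count from 0.\<close>

definition reads :: "nat \<Rightarrow> nat list \<Rightarrow> nat list \<Rightarrow> bool" where
  "reads j p w \<longleftrightarrow> set p \<subseteq> {..2 ^ j} \<and> successively adjacent p \<and> map (gamma_letter j) p = w"

lemma reads_ConsD: "reads j (x # p) (a # w) \<Longrightarrow> reads j p w"
  by (cases p) (auto simp: reads_def)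

lemma reads_prefix: "reads j p (u @ v) \<Longrightarrow> \<exists>q. reads j q u"
  unfolding reads_def map_eq_append_conv successively_append_iff
  by (metis Un_subset_iff set_append successively_append_iff)

definition expand :: "nat \<Rightarrow> nat list \<Rightarrow> nat list" where
  "expand k w = concat (map (\<lambda>i. if i \<le> k then [1, Suc i] else [1]) w)"

lemma filter_sigma: "k < K \<Longrightarrow> filter (\<lambda>i. i \<le> Suc k) (sigma K w) = expand k w"
  by (induction w) (auto simp: sigma_def expand_def sigma_letter_def)

text \<open>Locates the \<open>1\<close> between visits to \<open>2 * x\<close> and
  \<open>2 * hd p\<close>: the midpoint if these differ, otherwise a step aside, to the left unless
  \<open>x = 0\<close>.\<close>

lemma odd_neighbour_exists:
  assumes "x \<le> 2 ^ j" and "p \<noteq> [] \<longrightarrow> adjacent x (hd p)" and "set p \<subseteq> {..2 ^ j}"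
  obtains y where "odd y" "y \<le> 2 ^ Suc j" "adjacent (2 * x) y"
    "p \<noteq> [] \<longrightarrow> adjacent y (2 * hd p)"
proof -
  consider "p \<noteq> []" "hd p = Suc x" | "p \<noteq> []" "x = Suc (hd p)" | "p = [] \<or> hd p = x" "x = 0"
    | "p = [] \<or> hd p = x" "x > 0"
    using assms(2) unfolding adjacent_def by (metis le_SucE le_antisym neq0_conv)
  then show thesis
  proof cases
    case 1
    then have "Suc x \<le> 2 ^ j" using assms(3) hd_in_set[of p] by auto
    with 1 show thesis by (intro that[of "2 * x + 1"]) (auto simp: adjacent_def)
  next
    case 2
    with assms(1) show thesis by (intro that[of "2 * x - 1"]) (auto simp: adjacent_def)
  next
    case 3
    then show thesis by (intro that[of 1]) (auto simp: adjacent_def)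
  next
    case 4
    with assms(1) show thesis by (intro that[of "2 * x - 1"]) (auto simp: adjacent_def)
  qed
qed

text \<open>
  The trailing \<open>1\<close> makes the word nonempty and gives the induction control over the first position
  of the new path.
\<close>

lemma reads_expand_aux:
  assumes "reads j p (filter (\<lambda>i. i \<le> k) w)"
    and "odd y" "y \<le> 2 ^ Suc j" "p \<noteq> [] \<longrightarrow> adjacent y (2 * hd p)"
  shows "\<exists>q. reads (Suc j) (y # q) (expand k w @ [1])"
  using assms
proof (induction w arbitrary: p y)
  case Nil
  then show ?case by (auto simp: reads_def expand_def)
next
  case (Cons a w)
  show ?case
  proof (cases "a \<le> k")
    \<comment> \<open>A deleted letter still contributes a \<open>1\<close>, read by waiting at
      \<open>y\<close>.\<close>
    case False
    with Cons obtain q where "reads (Suc j) (y # q) (expand k w @ [1])" by force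
    with False Cons.prems have "reads (Suc j) (y # y # q) (expand k (a # w) @ [1])"
      by (auto simp: reads_def expand_def adjacent_def)
    then show ?thesis by blast
  next
    case True
    with Cons.prems(1) obtain x p' where p: "p = x # p'" and x: "gamma_letter j x = a"
      by (auto simp: reads_def)
    have p': "reads j p' (filter (\<lambda>i. i \<le> k) w)"
      using Cons.prems(1) True unfolding p by (auto dest: reads_ConsD)
    have "x \<le> 2 ^ j" "p' \<noteq> [] \<longrightarrow> adjacent x (hd p')" "set p' \<subseteq> {..2 ^ j}"
      using Cons.prems(1) by (auto simp: reads_def p successively_Cons)
    \<comment> \<open>\<open>y\<close> reads the first \<open>1\<close> and \<open>2 * x\<close> the
      letter \<open>Suc a\<close>; \<open>z\<close> is for the \<open>1\<close> that starts the
      remaining word.\<close>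
    then obtain z where z: "odd z" "z \<le> 2 ^ Suc j" "adjacent (2 * x) z"
      "p' \<noteq> [] \<longrightarrow> adjacent z (2 * hd p')"
      by (rule odd_neighbour_exists)
    with Cons.IH[OF p'] obtain q where "reads (Suc j) (z # q) (expand k w @ [1])" by blast
    with True Cons.prems z x \<open>x \<le> 2 ^ j\<close>
    have "reads (Suc j) (y # 2 * x # z # q) (expand k (a # w) @ [1])"
      by (auto simp: reads_def expand_def p)
    then show ?thesis by blast
  qed
qed

lemma reads_expand:
  assumes "reads j p (filter (\<lambda>i. i \<le> k) w)"
  shows "\<exists>q. reads (Suc j) q (expand k w)"
proof -
  have p: "set p \<subseteq> {..2 ^ j}" using assms by (simp add: reads_def)
  obtain y where "odd y" "y \<le> 2 ^ Suc j" "p \<noteq> [] \<longrightarrow> adjacent y (2 * hd p)"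
  proof (cases "p = []")
    case True
    then show thesis by (intro that[of 1]) auto
  next
    case False
    then have "hd p \<in> set p" by simp
    with p have "hd p \<le> 2 ^ j" "p \<noteq> [] \<longrightarrow> adjacent (hd p) (hd p)"
      by (auto simp: adjacent_def)
    with p show thesis by (metis that odd_neighbour_exists)
  qed
  then obtain q where "reads (Suc j) (y # q) (expand k w @ [1])"
    using reads_expand_aux[OF assms] by blast
  then show ?thesis by (rule reads_prefix)
qed

lemma reads_iterated_sigma:
  assumes "j + 2 \<le> K" and "0 \<notin> set w"
  shows "\<exists>p. reads j p (filter (\<lambda>i. i \<le> j + 2) ((sigma K ^^ j) w))"
  using assms(1)
proof (induction j)
  case 0
  \<comment> \<open>\<open>gamma 0\<close> has only two positions, which are adjacent, so every word
    over \<open>{1, 2}\<close> can be read on it.\<close>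
  have "reads 0 (map (\<lambda>i. i - 1) u) u" if "set u \<subseteq> {1, 2}" for u
  proof -
    from that have "map (gamma_letter 0 \<circ> (\<lambda>i. i - 1)) u = u"
      by (intro map_idI) auto
    moreover from that have "adjacent (u ! i - 1) (u ! Suc i - 1)" if "Suc i < length u" for i
      using nth_mem[OF that] nth_mem[OF Suc_lessD[OF that]] by (auto simp: adjacent_def)
    ultimately show ?thesis
      using that by (auto simp: reads_def successively_conv_nth)
  qed
  moreover have "set (filter (\<lambda>i. i \<le> 2) w) \<subseteq> {1, 2}"
  proof
    fix a assume "a \<in> set (filter (\<lambda>i. i \<le> 2) w)"
    with assms(2) have "a \<noteq> 0" "a \<le> 2" by (auto intro: gr0I)
    then show "a \<in> {1, 2}" by auto
  qed
  ultimately have "\<exists>p. reads 0 p (filter (\<lambda>i. i \<le> 2) w)" by blast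
  then show ?case by (simp add: numeral_2_eq_2)
next
  case (Suc j)
  then obtain p where "reads j p (filter (\<lambda>i. i \<le> j + 2) ((sigma K ^^ j) w))" by auto
  from reads_expand[OF this] Suc.prems show ?case
    using filter_sigma[of "j + 2" K] by simp
qed


section \<open>The words \<open>\<alpha>\<close>\<close>

lemma alpha_Suc: "n \<ge> 1 \<Longrightarrow> alpha k (Suc n) = sigma k (alpha k n)"
  by (cases n) auto

lemma alpha_add: "n \<ge> 1 \<Longrightarrow> alpha k (n + j) = (sigma k ^^ j) (alpha k n)"
  by (induction j) (auto simp: alpha_Suc)

lemma set_alpha:
  assumes "n \<ge> 1" "k \<ge> 1"
  shows "set (alpha k n) = {1..min n k}"
  using assms(1)
proof (induction n rule: dec_induct)
  case base
  with assms(2) show ?case by auto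
next
  case (step n)
  have "set (sigma k w) = (\<Union>i\<in>set w. if i < k then {1, Suc i} else {1})" for w
    by (auto simp: sigma_def sigma_letter_def split: if_splits)
  then have "set (alpha k (Suc n)) = (\<Union>i\<in>{1..min n k}. if i < k then {1, Suc i} else {1})"
    using step by (simp add: alpha_Suc)
  also have "\<dots> = {1..min (Suc n) k}"
  proof (intro set_eqI iffI)
    fix a assume "a \<in> {1..min (Suc n) k}"
    then show "a \<in> (\<Union>i\<in>{1..min n k}. if i < k then {1, Suc i} else {1})"
    proof (cases "a = 1")
      case True
      with step.hyps assms(2) show ?thesis by (intro UN_I[of 1]) auto
    next
      case False
      with \<open>a \<in> {1..min (Suc n) k}\<close> show ?thesis by (intro UN_I[of "a - 1"]) auto
    qed
  qed (use step.hyps assms(2) in \<open>auto split: if_splits\<close>)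
  finally show ?case .
qed

text \<open>A discrete intermediate value theorem; if \<open>b\<close> is visited before
  \<open>a\<close>, the path is reversed.\<close>

lemma successively_adjacent_covers:
  assumes p: "successively adjacent p" and "a \<in> set p" "b \<in> set p" "a \<le> c" "c \<le> b"
  shows "c \<in> set p"
proof -
  have covers: "c \<in> set p"
    if p: "successively adjacent p" and ij: "i \<le> j" "j < length p" "p ! i \<le> c" "c \<le> p ! j"
    for p :: "nat list" and i j
  proof -
    have "\<bar>int (p ! Suc l) - int (p ! l)\<bar> \<le> 1" if "l < j" for l
    proof -
      from p ij(2) that have "adjacent (p ! l) (p ! Suc l)" by (simp add: successively_conv_nth)
      then show ?thesis unfolding adjacent_def by linarith
    qed
    with ij nat_intermed_int_val[of i j "\<lambda>l. int (p ! l)" "int c"]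
    obtain l where "l \<le> j" "p ! l = c" by auto
    with ij(2) show ?thesis by auto
  qed
  obtain i j where ij: "i < length p" "j < length p" "p ! i = a" "p ! j = b"
    using assms(2,3) by (metis in_set_conv_nth)
  show ?thesis
  proof (cases "i \<le> j")
    case True
    with covers[OF p, of i j] ij assms show ?thesis by simp
  next
    case False
    have "successively adjacent (rev p)"
      using p by (simp add: successively_rev adjacent_def conj_commute)
    moreover have "rev p ! (length p - Suc i) = a" "rev p ! (length p - Suc j) = b"
      using ij by (simp_all add: rev_nth)
    ultimately show ?thesis
      using covers[of "rev p" "length p - Suc i" "length p - Suc j"] False ij assms by auto
  qed
qed

text \<open>The two largest letters occur only at the two ends of \<open>gamma j\<close>, so a path
  reading both visits every position.\<close>

lemma generates_gamma:
  assumes "reads j p w" "j + 1 \<in> set w" "j + 2 \<in> set w"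
  shows "generates (gamma j) w"
proof -
  have p: "set p \<subseteq> {..2 ^ j}" "successively adjacent p" "map (gamma_letter j) p = w"
    using assms(1) by (auto simp: reads_def)
  from assms(2,3) have "j + 1 \<in> gamma_letter j ` set p" "j + 2 \<in> gamma_letter j ` set p"
    by (simp_all flip: p(3))
  then obtain x y where x: "x \<in> set p" "gamma_letter j x = j + 1"
    and y: "y \<in> set p" "gamma_letter j y = j + 2"
    by (elim imageE) simp
  have "x = 0" by (rule gamma_letter_eq_bottom) (rule x(2))
  moreover have "y = 2 ^ j" by (rule gamma_letter_eq_top) (use y p(1) in auto)
  ultimately have "c \<in> set p" if "c \<le> 2 ^ j" for c
    using successively_adjacent_covers[OF p(2) x(1) y(1), of c] that by simp
  with p(1) have set_p: "set p = {..2 ^ j}" by blast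
  \<comment> \<open>Times and positions are both shifted by one, since walks count from 1.\<close>
  define f where "f i = Suc (p ! (i - 1))" for i
  have "f ` {1..length p} = Suc ` (!) p ` {..<length p}"
  proof -
    have "{1..length p} = Suc ` {..<length p}"
      by (simp add: image_Suc_lessThan)
    then show ?thesis by (simp add: image_image f_def)
  qed
  also have "(!) p ` {..<length p} = set p"
    by (auto simp: set_conv_nth)
  also have "Suc ` \<dots> = {1..length (gamma j)}"
    unfolding set_p by (simp add: image_Suc_atMost)
  finally have image: "f ` {1..length p} = {1..length (gamma j)}" .
  have "\<bar>int (f (i + 1)) - int (f i)\<bar> \<le> 1" if "1 \<le> i" "i < length p" for i
  proof -
    obtain l where "i = Suc l" using \<open>1 \<le> i\<close> by (cases i) auto
    moreover from this p(2) that(2) have "adjacent (p ! l) (p ! Suc l)"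
      by (simp add: successively_conv_nth)
    ultimately show ?thesis by (auto simp: adjacent_def f_def)
  qed
  with image have "walk (length p) (length (gamma j)) f"
    by (simp add: walk_def)
  moreover have "w = reindex (gamma j) (length p) f"
  proof (rule nth_equalityI)
    show "length w = length (reindex (gamma j) (length p) f)"
      by (simp add: reindex_def del: upt_Suc flip: p(3))
  next
    fix i assume "i < length w"
    then have i: "i < length p" by (simp flip: p(3))
    from i p(1) have "p ! i \<in> {..2 ^ j}" by (meson nth_mem subsetD)
    then have "p ! i \<le> 2 ^ j" by simp
    then have "reindex (gamma j) (length p) f ! i = gamma_letter j (p ! i)"
      using i unfolding reindex_def
      by (subst nth_map) (auto simp: f_def gamma_nth simp del: upt_Suc)
    with i show "w ! i = reindex (gamma j) (length p) f ! i"
      by (simp flip: p(3))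
  qed
  ultimately show ?thesis unfolding generates_def by blast
qed

theorem theorem4:
  fixes k :: nat
  assumes "k \<ge> 2"
  shows "\<exists>\<gamma> :: nat list. \<forall>n \<ge> k. primitive_generator \<gamma> (alpha k n)"
proof (intro exI[of _ "gamma (k - 2)"] allI impI)
  fix n assume n: "n \<ge> k"
  define m where "m = n - (k - 2)"
  have m: "m \<ge> 1" "n = m + (k - 2)" using assms n by (auto simp: m_def)
  \<comment> \<open>As \<open>n\<close> is at least \<open>k\<close>, both \<open>k - 1\<close> and
    \<open>k\<close> occur in \<open>alpha k n\<close>, and deleting letters above \<open>k\<close>
    changes nothing.\<close>
  have "set (alpha k m) = {1..min m k}" "set (alpha k n) = {1..k}"
    using set_alpha[of m k] set_alpha[of n k] m assms n by auto
  moreover have "filter (\<lambda>i. i \<le> k) (alpha k n) = alpha k n"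
    using calculation by simp
  moreover have "k - 2 + 2 = k" using assms by simp
  moreover have "alpha k n = (sigma k ^^ (k - 2)) (alpha k m)"
    using alpha_add[OF m(1)] m(2) by simp
  ultimately obtain p where "reads (k - 2) p (alpha k n)"
    using reads_iterated_sigma[of "k - 2" k "alpha k m"] by auto
  then have "generates (gamma (k - 2)) (alpha k n)"
    by (rule generates_gamma) (use \<open>set (alpha k n) = {1..k}\<close> assms in auto)
  then show "primitive_generator (gamma (k - 2)) (alpha k n)"
    by (simp add: primitive_generator_def primitive_gamma)
qed

end
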